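(* Let $n\ge3$ and consider the flipped Penney-Ante game on strings of length $n$. Then there are exactly two optimal strategies for Player I, namely the string $HH\dots H$ consisting of $n$ heads and the string $TT\dots T$ consisting of $n$ tails. Under these strategies, Player I wins with probability $1/2$ (assuming optimal play by Player II).
   Context: Flipped Penney-Ante game with strings of length $n$: Player I chooses a string $A\in\{H,T\}^n$; Player II, seeing $A$, chooses $B\in\{H,T\}^n$, $B\neq A$. A fair coin is tossed repeatedly (independently), and the player whose string appears (as a block of consecutive tosses) last wins, i.e. Player I wins iff $B$ appears before $A$. A string $A$ is an optimal strategy for Player I if it maximizes $\min_{B\ne A}P(B\text{ appears before }A)$ over all $A\in\{H,T\}^n$. *)

theory Defs
  imports "HOL-Probability.Probability"
begin

datatype coin = Heads | Tails

instance coin :: finite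
proof
  have "(UNIV :: coin set) \<subseteq> {Heads, Tails}"
    using coin.exhaust by blast
  then show "finite (UNIV :: coin set)"
    by (rule finite_subset) simp
qed

definition fair_coin :: "coin pmf" where
  "fair_coin = pmf_of_set {Heads, Tails}"

definition coin_tosses :: "coin stream measure" where
  "coin_tosses = stream_space (measure_pmf fair_coin)"

definition strings :: "nat \<Rightarrow> coin list set" where
  "strings n = {A. length A = n}"

definition occurs_at :: "coin list \<Rightarrow> coin stream \<Rightarrow> nat \<Rightarrow> bool" where
  "occurs_at A \<omega> k \<longleftrightarrow> stake (length A) (sdrop k \<omega>) = A"

(* Start positions are compared; as the two strings in the game have equal length, this is the
   same as comparing the tosses at which they are completed.  B also counts as appearing before A
   when A never appears. *)
definition appears_before :: "coin list \<Rightarrow> coin list \<Rightarrow> coin stream \<Rightarrow> bool" where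
  "appears_before B A \<omega> \<longleftrightarrow> (\<exists>k. occurs_at B \<omega> k \<and> (\<forall>j\<le>k. \<not> occurs_at A \<omega> j))"

(* Flipped rule: Player I, with string A, wins iff the opponent's string B appears first. *)
definition win_prob :: "coin list \<Rightarrow> coin list \<Rightarrow> real" where
  "win_prob A B = measure coin_tosses {\<omega> \<in> space coin_tosses. appears_before B A \<omega>}"

lemma appears_before_event:
  "{\<omega> \<in> space coin_tosses. appears_before B A \<omega>} \<in> sets coin_tosses"
  unfolding coin_tosses_def appears_before_def occurs_at_def by measurable

(* Player I's winning probability when Player II, seeing A, replies optimally. *)
definition value_against_best_reply :: "nat \<Rightarrow> coin list \<Rightarrow> real" where
  "value_against_best_reply n A = Min (win_prob A ` (strings n - {A}))"

definition optimal_strategy :: "nat \<Rightarrow> coin list \<Rightarrow> bool" where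
  "optimal_strategy n A \<longleftrightarrow>
     A \<in> strings n \<and>
     (\<forall>A' \<in> strings n. value_against_best_reply n A' \<le> value_against_best_reply n A)"

end

theory Submission
  imports Defs
begin

text \<open>
  Conway's identity for Penney's game, proved by counting: if neither string has been completed
  within the first \<open>t\<close> tosses and the next \<open>n\<close> tosses spell \<open>B\<close>, then the first string completed,
  be it \<open>A\<close> or \<open>B\<close>, overlaps this copy of \<open>B\<close>, and the tosses after it are independent of it.
  Summing over \<open>t\<close> expresses the expected duration, divided by \<open>2 ^ n\<close>, through the
  winning probabilities and the overlaps of \<open>A\<close> and \<open>B\<close> with \<open>B\<close>; exchanging the roles of \<open>A\<close> and
  \<open>B\<close> yields a linear relation between the two winning probabilities.  If \<open>A\<close> is constant, comparing
  overlaps term by term shows that \<open>A\<close> is at most as likely as \<open>B\<close> to appear first, and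
  strictly less likely if \<open>B\<close> is not constant and starts with the other letter.
\<close>

section \<open>Independence of disjoint blocks of tosses\<close>

lemma space_coin_tosses [simp]: "space coin_tosses = UNIV"
  by (simp add: coin_tosses_def space_stream_space)

interpretation coin_tosses: prob_space coin_tosses
  unfolding coin_tosses_def
  by (rule prob_space.prob_space_stream_space) (rule prob_space_measure_pmf)

lemma UNIV_coin: "UNIV = {Heads, Tails}"
  using coin.exhaust by blast

lemma emeasure_fair_coin_single: "emeasure (measure_pmf fair_coin) {a} = ennreal (1 / 2)"
  by (cases a) (simp_all add: fair_coin_def emeasure_pmf_single)

lemma sets_stake_sdrop:
  assumes "E \<in> sets coin_tosses"
  shows "{\<omega>. stake m \<omega> = u \<and> sdrop m \<omega> \<in> E} \<in> sets coin_tosses"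
proof -
  have [measurable]: "E \<in> sets (stream_space (measure_pmf fair_coin))"
    using assms by (simp add: coin_tosses_def)
  have "{\<omega> \<in> space coin_tosses. stake m \<omega> = u \<and> sdrop m \<omega> \<in> E} \<in> sets coin_tosses"
    unfolding coin_tosses_def by measurable
  then show ?thesis by simp
qed

lemma emeasure_stake_sdrop:
  assumes E: "E \<in> sets coin_tosses"
  shows "emeasure coin_tosses {\<omega>. stake (length u) \<omega> = u \<and> sdrop (length u) \<omega> \<in> E}
    = ennreal ((1 / 2) ^ length u) * emeasure coin_tosses E"
proof (induction u)
  case Nil
  then show ?case by simp
next
  case (Cons a u)
  let ?X = "\<lambda>u. {\<omega>. stake (length u) \<omega> = u \<and> sdrop (length u) \<omega> \<in> E}"
  have "emeasure coin_tosses (?X (a # u))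
    = (\<integral>\<^sup>+ t. emeasure coin_tosses {\<omega> \<in> space coin_tosses. t ## \<omega> \<in> ?X (a # u)} \<partial>measure_pmf fair_coin)"
    using prob_space.emeasure_stream_space[OF prob_space_measure_pmf, of "?X (a # u)" fair_coin]
      sets_stake_sdrop[OF E] by (simp only: coin_tosses_def)
  \<comment> \<open>Once the first toss is fixed as \<open>t\<close>, the event is
    \<open>?X u\<close> if \<open>t = a\<close> and empty otherwise.\<close>
  also have "\<dots> = (\<integral>\<^sup>+ t. emeasure coin_tosses (?X u) * indicator {a} t \<partial>measure_pmf fair_coin)"
    by (intro nn_integral_cong) (auto simp: indicator_def)
  also have "\<dots> = emeasure coin_tosses (?X u) * ennreal (1 / 2)"
    by (simp add: nn_integral_cmult_indicator emeasure_fair_coin_single)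
  also have "\<dots> = ennreal (1 / 2) * ennreal ((1 / 2) ^ length u) * emeasure coin_tosses E"
    by (simp add: Cons.IH mult_ac)
  also have "ennreal (1 / 2) * ennreal ((1 / 2) ^ length u) = ennreal ((1 / 2) ^ length (a # u))"
    by (subst ennreal_mult[symmetric]) simp_all
  finally show ?case .
qed

lemma prob_stake_sdrop:
  assumes "E \<in> sets coin_tosses" "length u = m"
  shows "coin_tosses.prob {\<omega>. stake m \<omega> = u \<and> sdrop m \<omega> \<in> E} = (1 / 2) ^ m * coin_tosses.prob E"
  using emeasure_stake_sdrop[OF assms(1), of u] assms(2)
  by (simp add: coin_tosses.emeasure_eq_measure ennreal_mult[symmetric])

lemma finite_strings: "finite (strings n)"
  using finite_lists_length_eq[of "UNIV :: coin set" n] by (simp add: strings_def)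

text \<open>An event fixed by the first \<open>m\<close> tosses is a finite disjoint union of
  cylinders, each of mass \<open>(1 / 2) ^ m\<close> and independent of the tosses after it. The
  tail \<open>sconst Heads\<close> is an arbitrary completion of a prefix to a stream, on which
  \<open>P\<close> can be evaluated.\<close>

lemma prob_determined_prefix:
  assumes P: "\<And>\<omega> \<omega>'. stake m \<omega> = stake m \<omega>' \<Longrightarrow> P \<omega> = P \<omega>'" and E: "E \<in> sets coin_tosses"
  shows "coin_tosses.prob {\<omega>. P \<omega> \<and> sdrop m \<omega> \<in> E}
    = real (card {u \<in> strings m. P (u @- sconst Heads)}) * (1 / 2) ^ m * coin_tosses.prob E"
proof -
  let ?U = "{u \<in> strings m. P (u @- sconst Heads)}"
  let ?X = "\<lambda>u. {\<omega>. stake m \<omega> = u \<and> sdrop m \<omega> \<in> E}"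
  have Peq: "P \<omega> = P (stake m \<omega> @- sconst Heads)" for \<omega>
    by (rule P) (simp add: stake_shift)
  have "{\<omega>. P \<omega> \<and> sdrop m \<omega> \<in> E} = (\<Union>u\<in>?U. ?X u)"
  proof (rule set_eqI)
    fix \<omega>
    show "\<omega> \<in> {\<omega>. P \<omega> \<and> sdrop m \<omega> \<in> E} \<longleftrightarrow> \<omega> \<in> (\<Union>u\<in>?U. ?X u)"
      using Peq[of \<omega>] by (simp add: strings_def)
  qed
  also have "coin_tosses.prob \<dots> = (\<Sum>u\<in>?U. coin_tosses.prob (?X u))"
    using finite_strings[of m] sets_stake_sdrop[OF E]
    by (intro coin_tosses.finite_measure_finite_Union) (auto simp: disjoint_family_on_def)
  also have "\<dots> = (\<Sum>u\<in>?U. (1 / 2) ^ m * coin_tosses.prob E)"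
    by (intro sum.cong prob_stake_sdrop[OF E]) (auto simp: strings_def)
  finally show ?thesis by simp
qed

text \<open>The counting formula is applied twice, with the block as tail event and with the sure
  event; both contain the same number of prefixes, so the count disappears.\<close>

lemma prob_prefix_block:
  assumes P: "\<And>\<omega> \<omega>'. stake m \<omega> = stake m \<omega>' \<Longrightarrow> P \<omega> = P \<omega>'" and "length u = d"
  shows "coin_tosses.prob {\<omega>. P \<omega> \<and> stake d (sdrop m \<omega>) = u} = coin_tosses.prob {\<omega>. P \<omega>} * (1 / 2) ^ d"
proof -
  have U: "UNIV \<in> sets coin_tosses"
    using sets.top[of coin_tosses] by simp
  have "coin_tosses.prob {\<omega>. stake d \<omega> = u} = (1 / 2) ^ d"
    using prob_stake_sdrop[OF U assms(2)] coin_tosses.prob_space by simp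
  moreover have "{\<omega>. stake d \<omega> = u} \<in> sets coin_tosses"
    using sets_stake_sdrop[OF U, of d u] by simp
  ultimately show ?thesis
    using prob_determined_prefix[OF P, where E = "{\<omega>. stake d \<omega> = u}"] prob_determined_prefix[OF P U]
      coin_tosses.prob_space by simp
qed

section \<open>Conway's identity\<close>

text \<open>Conway's leading number of \<open>A\<close> over \<open>B\<close>, divided by \<open>2 ^ (length A - 1)\<close>.\<close>

definition correlation :: "'a list \<Rightarrow> 'a list \<Rightarrow> real" where
  "correlation A B =
    (\<Sum>d<length A. of_bool (drop d A = take (length A - d) B) * (1 / 2) ^ d)"

text \<open>The bound is on the end of an occurrence, so for strings of equal length this event
  depends on the first \<open>t\<close> tosses only.\<close>

definition undecided :: "coin list \<Rightarrow> coin list \<Rightarrow> nat \<Rightarrow> coin stream \<Rightarrow> bool" where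
  "undecided A B t \<omega> \<longleftrightarrow> (\<forall>i. i + length A \<le> t \<longrightarrow> \<not> occurs_at A \<omega> i \<and> \<not> occurs_at B \<omega> i)"

text \<open>Only starts before \<open>k\<close> are excluded: distinct strings of equal length
  cannot both start at \<open>k\<close>.\<close>

definition first_hit :: "coin list set \<Rightarrow> coin list \<Rightarrow> nat \<Rightarrow> coin stream \<Rightarrow> bool" where
  "first_hit S A k \<omega> \<longleftrightarrow> occurs_at A \<omega> k \<and> (\<forall>i<k. \<forall>C\<in>S. \<not> occurs_at C \<omega> i)"

lemma sets_first_hit:
  assumes "finite S"
  shows "{\<omega>. first_hit S A k \<omega>} \<in> sets coin_tosses"
proof -
  have "{\<omega> \<in> space coin_tosses. first_hit S A k \<omega>} \<in> sets coin_tosses"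
    unfolding coin_tosses_def first_hit_def occurs_at_def
    using countable_finite[OF assms] by measurable
  then show ?thesis by simp
qed

lemma sets_occurs_at: "{\<omega>. occurs_at A \<omega> k} \<in> sets coin_tosses"
proof -
  have "{\<omega> \<in> space coin_tosses. occurs_at A \<omega> k} \<in> sets coin_tosses"
    unfolding coin_tosses_def occurs_at_def by measurable
  then show ?thesis by simp
qed

section \<open>Overlapping occurrences and first hits\<close>

lemma occurs_at_prefix:
  assumes "stake m \<omega> = stake m \<omega>'" "k + length A \<le> m"
  shows "occurs_at A \<omega> k = occurs_at A \<omega>' k"
proof -
  have "stake (length A) (sdrop k \<omega>) = take (length A) (drop k (stake m \<omega>))" for \<omega> :: "coin stream"
    using assms(2) by (simp add: drop_stake take_stake min_def)
  then show ?thesis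
    using assms(1) by (simp add: occurs_at_def)
qed

text \<open>The window of \<open>B\<close> is cut at \<open>k + n\<close>: its first
  \<open>n - d\<close> tosses are the tail of \<open>A\<close>, and its last \<open>d\<close> tosses
  lie beyond \<open>A\<close>.\<close>

lemma occurs_at_overlap:
  assumes "length A = n" "length B = n" "d \<le> n" "occurs_at A \<omega> k"
  shows "occurs_at B \<omega> (k + d) \<longleftrightarrow>
    drop d A = take (n - d) B \<and> stake d (sdrop (k + n) \<omega>) = drop (n - d) B"
proof -
  have "stake n (sdrop (k + d) \<omega>)
    = stake (n - d) (sdrop (k + d) \<omega>) @ stake d (sdrop (k + n) \<omega>)"
    using stake_add[of "n - d" "sdrop (k + d) \<omega>" d] assms(3) by (simp add: add_ac)
  moreover have "stake (n - d) (sdrop (k + d) \<omega>) = drop d A"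
    using assms(1,4) drop_stake[of d n "sdrop k \<omega>"] by (simp add: occurs_at_def add.commute)
  ultimately show ?thesis
    using assms(1-3) by (auto simp: occurs_at_def append_eq_conv_conj)
qed

text \<open>This is the source of the summands of \<open>correlation\<close>. The first hit is
  settled by the tosses before \<open>k + n\<close>; whether the overlap fits is a property of the
  strings alone, and the remaining \<open>d\<close> letters of \<open>B\<close> are fresh
  tosses.\<close>

lemma prob_first_hit_overlap:
  assumes "A \<in> S" "\<And>C. C \<in> S \<Longrightarrow> length C = n" "length B = n" "d \<le> n"
  shows "coin_tosses.prob {\<omega>. first_hit S A k \<omega> \<and> occurs_at B \<omega> (k + d)}
    = of_bool (drop d A = take (n - d) B) * (1 / 2) ^ d * coin_tosses.prob {\<omega>. first_hit S A k \<omega>}"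
proof (cases "drop d A = take (n - d) B")
  case True
  have eq: "{\<omega>. first_hit S A k \<omega> \<and> occurs_at B \<omega> (k + d)}
    = {\<omega>. first_hit S A k \<omega> \<and> stake d (sdrop (k + n) \<omega>) = drop (n - d) B}"
    using occurs_at_overlap[OF assms(2)[OF assms(1)] assms(3,4)] True
    by (auto simp: first_hit_def)
  have F: "first_hit S A k \<omega> = first_hit S A k \<omega>'"
    if "stake (k + n) \<omega> = stake (k + n) \<omega>'" for \<omega> \<omega>'
    using occurs_at_prefix[OF that] assms(1,2) by (simp add: first_hit_def)
  have "length (drop (n - d) B) = d"
    using assms(3,4) by simp
  from prob_prefix_block[of "k + n" "first_hit S A k", OF F this] show ?thesis
    using eq True by simp
next
  case False
  then have empty: "{\<omega>. first_hit S A k \<omega> \<and> occurs_at B \<omega> (k + d)} = {}"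
    using occurs_at_overlap[OF assms(2)[OF assms(1)] assms(3,4)]
    by (auto simp: first_hit_def)
  from False show ?thesis unfolding empty by simp
qed

lemma occurs_at_same_length:
  assumes "occurs_at A \<omega> k" "occurs_at B \<omega> k" "length A = length B"
  shows "A = B"
  using assms by (simp add: occurs_at_def)

lemma first_hit_unique:
  assumes "first_hit S A i \<omega>" "first_hit S B j \<omega>" "A \<in> S" "B \<in> S"
  shows "i = j"
  using assms by (metis first_hit_def linorder_neqE_nat)

lemma first_hit_exists:
  assumes "occurs_at A \<omega> k" "A \<in> S"
  shows "\<exists>C\<in>S. \<exists>j\<le>k. first_hit S C j \<omega>"
proof -
  have "\<exists>j. \<exists>C\<in>S. occurs_at C \<omega> j"
    using assms by blast
  then obtain j C where j: "C \<in> S" "occurs_at C \<omega> j" "\<forall>i<j. \<not> (\<exists>C\<in>S. occurs_at C \<omega> i)"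
    unfolding exists_least_iff[of "\<lambda>j. \<exists>C\<in>S. occurs_at C \<omega> j"] by blast
  with assms have "j \<le> k"
    by (meson not_le)
  with j show ?thesis
    by (auto simp: first_hit_def)
qed

lemma appears_before_iff_first_hit:
  assumes "length A = length B" "A \<noteq> B"
  shows "appears_before B A \<omega> \<longleftrightarrow> (\<exists>k. first_hit {A, B} B k \<omega>)"
proof
  assume "appears_before B A \<omega>"
  then obtain k where k: "occurs_at B \<omega> k" "\<forall>j\<le>k. \<not> occurs_at A \<omega> j"
    by (auto simp: appears_before_def)
  obtain C j where C: "C \<in> {A, B}" "j \<le> k" "first_hit {A, B} C j \<omega>"
    using first_hit_exists[OF k(1), of "{A, B}"] by auto
  with k(2) have "C \<noteq> A"
    by (auto simp: first_hit_def)
  with C have "first_hit {A, B} B j \<omega>"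
    by simp
  then show "\<exists>k. first_hit {A, B} B k \<omega>" ..
next
  assume "\<exists>k. first_hit {A, B} B k \<omega>"
  then obtain k where k: "first_hit {A, B} B k \<omega>" ..
  then have "\<not> occurs_at A \<omega> k"
    using occurs_at_same_length assms by (auto simp: first_hit_def)
  with k show "appears_before B A \<omega>"
    by (auto simp: appears_before_def first_hit_def le_less)
qed

lemma first_hit_sums_win_prob:
  assumes "length A = length B" "A \<noteq> B"
  shows "(\<lambda>k. coin_tosses.prob {\<omega>. first_hit {A, B} B k \<omega>}) sums win_prob A B"
proof -
  have "(\<lambda>k. coin_tosses.prob {\<omega>. first_hit {A, B} B k \<omega>}) sums
    coin_tosses.prob (\<Union>k. {\<omega>. first_hit {A, B} B k \<omega>})"
  proof (rule coin_tosses.finite_measure_UNION)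
    show "disjoint_family (\<lambda>k. {\<omega>. first_hit {A, B} B k \<omega>})"
      using first_hit_unique[of "{A, B}" B _ _ B] by (auto simp: disjoint_family_on_def)
  qed (auto simp: sets_first_hit)
  moreover have "(\<Union>k. {\<omega>. first_hit {A, B} B k \<omega>}) = {\<omega>. appears_before B A \<omega>}"
    using appears_before_iff_first_hit[OF assms] by auto
  ultimately show ?thesis by (simp add: win_prob_def)
qed

section \<open>Summation over the duration of the game\<close>

lemma sums_delay:
  fixes f :: "nat \<Rightarrow> 'a :: real_normed_vector"
  assumes "f sums s"
  shows "(\<lambda>t. if d \<le> t then f (t - d) else 0) sums s"
  using assms sums_iff_shift[of "\<lambda>t. if d \<le> t then f (t - d) else 0" d s] by simp

text \<open>The copy of \<open>B\<close> at \<open>t\<close> forces some first hit at a start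
  \<open>k \<le> t\<close>, and undecidedness gives \<open>t < k + n\<close>, so
  \<open>d = t - k\<close> is below \<open>n\<close>. Conversely, an occurrence completed within
  \<open>t\<close> tosses would start before \<open>t - d\<close>. The guard
  \<open>d \<le> t\<close> rules out truncated subtraction.\<close>

lemma undecided_then_occurs:
  assumes "length A = n" "length B = n" "n > 0"
  shows "undecided A B t \<omega> \<and> occurs_at B \<omega> t \<longleftrightarrow>
    (\<exists>C\<in>{A, B}. \<exists>d<n. d \<le> t \<and> first_hit {A, B} C (t - d) \<omega> \<and> occurs_at B \<omega> t)"
proof
  assume L: "undecided A B t \<omega> \<and> occurs_at B \<omega> t"
  then obtain C k where C: "C \<in> {A, B}" "k \<le> t" "first_hit {A, B} C k \<omega>"
    using first_hit_exists[of B \<omega> t "{A, B}"] by auto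
  with L have "t < k + n"
    using assms(1) by (auto simp: undecided_def first_hit_def not_less[symmetric])
  then have "t - k < n" "t - k \<le> t" "t - (t - k) = k"
    using C(2) by auto
  with C L show "\<exists>C\<in>{A, B}. \<exists>d<n. d \<le> t \<and> first_hit {A, B} C (t - d) \<omega> \<and> occurs_at B \<omega> t"
    by metis
next
  assume "\<exists>C\<in>{A, B}. \<exists>d<n. d \<le> t \<and> first_hit {A, B} C (t - d) \<omega> \<and> occurs_at B \<omega> t"
  then show "undecided A B t \<omega> \<and> occurs_at B \<omega> t"
    using assms by (auto simp: undecided_def first_hit_def)
qed

text \<open>A renewal equation. The event that the game is undecided at \<open>t\<close> and
  \<open>B\<close> follows is split by the first string \<open>C\<close> and its distance
  \<open>d\<close> from \<open>t\<close>, then summed over \<open>t\<close>. Since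
  \<open>win_prob B A\<close> is the probability that \<open>A\<close> comes first, it is the weight
  of \<open>correlation A B\<close>.\<close>

lemma undecided_prob_sums:
  assumes len: "length A = n" "length B = n" and "A \<noteq> B"
  shows "(\<lambda>t. coin_tosses.prob {\<omega>. undecided A B t \<omega>} * (1 / 2) ^ n) sums
    (correlation A B * win_prob B A + correlation B B * win_prob A B)"
proof -
  have "n > 0" using assms by auto
  let ?S = "{A, B}"
  let ?f = "\<lambda>C k. coin_tosses.prob {\<omega>. first_hit ?S C k \<omega>}"
  let ?g = "\<lambda>C t d. of_bool (drop d C = take (n - d) B) * (1 / 2) ^ d
    * (if d \<le> t then ?f C (t - d) else 0)"
  let ?G = "\<lambda>t (C, d). {\<omega>. d \<le> t \<and> first_hit ?S C (t - d) \<omega> \<and> occurs_at B \<omega> t}"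
  have "coin_tosses.prob {\<omega>. undecided A B t \<omega>} * (1 / 2) ^ n = (\<Sum>C\<in>?S. \<Sum>d<n. ?g C t d)" for t
  proof -
    have U: "undecided A B t \<omega> = undecided A B t \<omega>'" if "stake t \<omega> = stake t \<omega>'" for \<omega> \<omega>'
      using occurs_at_prefix[OF that] len by (auto simp: undecided_def)
    \<comment> \<open>The \<open>n\<close> tosses from \<open>t\<close> on are independent of
      undecidedness at \<open>t\<close>, so the factor is the probability that they spell
      \<open>B\<close>.\<close>
    have "coin_tosses.prob {\<omega>. undecided A B t \<omega>} * (1 / 2) ^ n
      = coin_tosses.prob {\<omega>. undecided A B t \<omega> \<and> occurs_at B \<omega> t}"
      using prob_prefix_block[of t "undecided A B t", OF U len(2)] len by (simp add: occurs_at_def)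
    also have "{\<omega>. undecided A B t \<omega> \<and> occurs_at B \<omega> t} = (\<Union>x\<in>?S \<times> {..<n}. ?G t x)"
      by (simp only: undecided_then_occurs[OF len \<open>n > 0\<close>]) auto
    also have "coin_tosses.prob \<dots> = (\<Sum>x\<in>?S \<times> {..<n}. coin_tosses.prob (?G t x))"
    proof (rule coin_tosses.finite_measure_finite_Union)
      show "?G t ` (?S \<times> {..<n}) \<subseteq> sets coin_tosses"
      proof
        fix X assume "X \<in> ?G t ` (?S \<times> {..<n})"
        then obtain C d where X: "X = ?G t (C, d)" by blast
        have "?G t (C, d) = (if d \<le> t then {\<omega>. first_hit ?S C (t - d) \<omega>} \<inter> {\<omega>. occurs_at B \<omega> t} else {})"
          by auto
        then show "X \<in> sets coin_tosses"
          using X sets_first_hit[of ?S C "t - d"] sets_occurs_at[of B t] by auto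
      qed
      \<comment> \<open>Disjointness: the start of the first hit is unique, which fixes
        \<open>d\<close>, and the toss block there fixes the string.\<close>
      have "C = C' \<and> d = d'" if "C \<in> ?S" "C' \<in> ?S" "d \<le> t" "d' \<le> t"
        "first_hit ?S C (t - d) \<omega>" "first_hit ?S C' (t - d') \<omega>" for C C' d d' \<omega>
      proof -
        have "t - d = t - d'"
          using first_hit_unique[OF that(5,6,1,2)] .
        moreover from this have "C = C'"
          using that occurs_at_same_length[of C \<omega> "t - d" C'] len by (auto simp: first_hit_def)
        ultimately show ?thesis using that(3,4) by auto
      qed
      then show "disjoint_family_on (?G t) (?S \<times> {..<n})"
        unfolding disjoint_family_on_def by blast
    qed simp
    also have "\<dots> = (\<Sum>C\<in>?S. \<Sum>d<n. coin_tosses.prob (?G t (C, d)))"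
      by (simp only: sum.cartesian_product) (simp add: case_prod_unfold)
    also have "\<dots> = (\<Sum>C\<in>?S. \<Sum>d<n. ?g C t d)"
    proof (intro sum.cong refl)
      fix C d assume C: "C \<in> ?S" and d: "d \<in> {..<n}"
      have lenS: "length D = n" if "D \<in> ?S" for D
        using that len by auto
      show "coin_tosses.prob (?G t (C, d)) = ?g C t d"
        using prob_first_hit_overlap[OF C lenS len(2), of d "t - d"] d by (cases "d \<le> t") simp_all
    qed
    finally show ?thesis .
  qed
  \<comment> \<open>For each fixed \<open>d\<close>, the series over \<open>t\<close> is that of the
    first hits with \<open>d\<close> zeros in front, so it still sums to \<open>w\<close>.\<close>
  moreover have "(\<lambda>t. \<Sum>d<n. ?g C t d) sums (correlation C B * w)"
    if "?f C sums w" "length C = n" for C w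
    unfolding correlation_def sum_distrib_right that(2)
    by (intro sums_sum sums_mult sums_delay that(1))
  moreover have "?f A sums win_prob B A" "?f B sums win_prob A B"
    using first_hit_sums_win_prob[of A B] first_hit_sums_win_prob[of B A] assms
    by (simp_all add: insert_commute)
  ultimately show ?thesis
    using assms by (simp add: sums_add)
qed

text \<open>The game ends almost surely: the undecided probabilities form a convergent series by the
  renewal equation, so they tend to 0.\<close>

lemma win_prob_sum:
  assumes len: "length A = n" "length B = n" and "A \<noteq> B"
  shows "win_prob A B + win_prob B A = 1"
proof -
  let ?W = "\<lambda>A B. {\<omega>. appears_before B A \<omega>}"
  have W [simp]: "?W A B \<in> sets coin_tosses" for A B
    using appears_before_event[of B A] by simp
  have "?W A B \<inter> ?W B A = {}"
    unfolding appears_before_def using nat_le_linear by blast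
  then have u: "win_prob A B + win_prob B A = coin_tosses.prob (?W A B \<union> ?W B A)"
    using coin_tosses.finite_measure_Union[OF W W] by (simp add: win_prob_def)
  \<comment> \<open>If neither player ever wins there is no first hit, hence no occurrence at all,
    and the game is undecided at every \<open>t\<close>.\<close>
  have le: "1 - (win_prob A B + win_prob B A) \<le> coin_tosses.prob {\<omega>. undecided A B t \<omega>}" for t
  proof -
    have "undecided A B t \<omega>" if "\<not> appears_before B A \<omega>" "\<not> appears_before A B \<omega>" for \<omega>
    proof -
      have "\<not> first_hit {A, B} C k \<omega>" if "C \<in> {A, B}" for C k
        using appears_before_iff_first_hit[of A B \<omega>] appears_before_iff_first_hit[of B A \<omega>] assms that
          \<open>\<not> appears_before B A \<omega>\<close> \<open>\<not> appears_before A B \<omega>\<close>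
        by (auto simp: insert_commute)
      then show ?thesis
        using first_hit_exists[of _ \<omega> _ "{A, B}"] by (auto simp: undecided_def)
    qed
    then have "UNIV - (?W A B \<union> ?W B A) \<subseteq> {\<omega>. undecided A B t \<omega>}"
      by auto
    moreover have "{\<omega>. undecided A B t \<omega>} \<in> sets coin_tosses"
    proof -
      have "{\<omega> \<in> space coin_tosses. undecided A B t \<omega>} \<in> sets coin_tosses"
        unfolding coin_tosses_def undecided_def occurs_at_def by measurable
      then show ?thesis by simp
    qed
    ultimately have "coin_tosses.prob (UNIV - (?W A B \<union> ?W B A)) \<le> coin_tosses.prob {\<omega>. undecided A B t \<omega>}"
      by (rule coin_tosses.finite_measure_mono)
    then show ?thesis
      using coin_tosses.prob_compl[OF sets.Un[OF W[of B A] W[of A B]]] u by (simp add: Un_commute)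
  qed
  have "(\<lambda>t. coin_tosses.prob {\<omega>. undecided A B t \<omega>} * (1 / 2) ^ n) \<longlonglongrightarrow> 0"
    using undecided_prob_sums[OF assms] by (intro summable_LIMSEQ_zero sums_summable)
  then have "(1 - (win_prob A B + win_prob B A)) * (1 / 2) ^ n \<le> 0"
    by (rule LIMSEQ_le_const) (use le in \<open>auto intro!: exI mult_right_mono\<close>)
  then have "win_prob A B + win_prob B A \<ge> 1"
    by (simp add: mult_le_0_iff power_le_zero_eq)
  then show ?thesis
    using u coin_tosses.prob_le_1[of "?W A B \<union> ?W B A"] by linarith
qed

text \<open>Undecidedness is symmetric in \<open>A\<close> and \<open>B\<close>, so the renewal
  equations for a following \<open>B\<close> and a following \<open>A\<close> evaluate the same
  series.\<close>

theorem Conway_identity: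
  assumes "length A = n" "length B = n" "A \<noteq> B"
  shows "win_prob A B * (correlation B B - correlation B A)
    = win_prob B A * (correlation A A - correlation A B)"
proof -
  have "undecided A B = undecided B A"
    using assms by (auto simp: undecided_def fun_eq_iff)
  then have "correlation A B * win_prob B A + correlation B B * win_prob A B
    = correlation B A * win_prob A B + correlation A A * win_prob B A"
    using undecided_prob_sums[OF assms] undecided_prob_sums[OF assms(2,1) assms(3)[symmetric]]
    by (auto intro: sums_unique2)
  then show ?thesis
    by (simp add: algebra_simps)
qed

section \<open>Constant strings\<close>

text \<open>If both overlaps on the left hold, \<open>take (n - d) B\<close> consists of letters
  \<open>c\<close> and equals \<open>drop d B\<close>, so the right side is 2 as well. The summand 1
  stands for the overlap of the constant string with itself.\<close>

lemma overlap_replicate_le: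
  assumes "length B = n" "d \<le> n"
  shows "of_bool (drop d B = take (n - d) B) + of_bool (drop d (replicate n c) = take (n - d) B)
    \<le> (1 :: real) + of_bool (drop d B = take (n - d) (replicate n c))"
  using assms by (auto simp: min_def)

text \<open>The first part compares overlaps shift by shift. The second makes the factor in Conway's
  identity positive, so that it can be cancelled; strictness comes from shift 0, where the overlap
  means equality of the strings.\<close>

lemma correlation_replicate:
  assumes B: "length B = n" "B \<noteq> replicate n c"
  defines "A \<equiv> replicate n c"
  shows "correlation B B - correlation B A \<le> correlation A A - correlation A B"
    and "correlation A B < correlation A A"
proof -
  let ?o = "\<lambda>X Y d. of_bool (drop d X = take (n - d) Y) :: real"
  have len: "length A = n" by (simp add: A_def)
  have "n > 0" using B by auto
  have AA: "?o A A d = 1" if "d < n" for d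
    using that by (simp add: A_def min_def)
  have "correlation B B + correlation A B \<le> correlation A A + correlation B A"
    unfolding correlation_def len B(1) sum.distrib[symmetric] distrib_right[symmetric]
    using overlap_replicate_le[OF B(1)] AA
    by (intro sum_mono mult_right_mono) (simp_all add: A_def)
  then show "correlation B B - correlation B A \<le> correlation A A - correlation A B"
    by linarith
  show "correlation A B < correlation A A"
    unfolding correlation_def len
  proof (rule sum_strict_mono_ex1)
    show "\<forall>d\<in>{..<n}. ?o A B d * (1 / 2) ^ d \<le> ?o A A d * (1 / 2) ^ d"
      using AA by (auto simp del: of_bool_eq_1_iff)
    show "\<exists>d\<in>{..<n}. ?o A B d * (1 / 2) ^ d < ?o A A d * (1 / 2) ^ d"
      using AA[of 0] B \<open>n > 0\<close> by (intro bexI[of _ 0]) (auto simp: A_def)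
  qed simp
qed

lemma constant_if_shift_invariant:
  assumes "drop 1 B = take (length B - 1) B"
  shows "B = replicate (length B) (hd B)"
proof -
  have "i < length B \<Longrightarrow> B ! i = hd B" for i
  proof (induction i)
    case 0
    then show ?case by (simp add: hd_conv_nth)
  next
    case (Suc i)
    have "drop 1 B ! i = take (length B - 1) B ! i"
      using assms by simp
    with Suc show ?case by simp
  qed
  then show ?thesis by (intro nth_equalityI) auto
qed

text \<open>Shift 1 is where strictness arises: both overlaps with \<open>B\<close> fail there,
  while the constant string overlaps itself.\<close>

lemma correlation_replicate_strict:
  assumes B: "length B = n" "n \<ge> 2" "hd B \<noteq> c" "B \<noteq> replicate n (hd B)"
  defines "A \<equiv> replicate n c"
  shows "correlation B B - correlation B A < correlation A A - correlation A B"
proof -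
  let ?o = "\<lambda>X Y d. of_bool (drop d X = take (n - d) Y) :: real"
  have len: "length A = n" by (simp add: A_def)
  have AA: "?o A A d = 1" if "d < n" for d
    using that by (simp add: A_def min_def)
  \<comment> \<open>A self-overlap at shift 1 makes consecutive letters equal, hence
    \<open>B\<close> constant.\<close>
  have BB1: "?o B B 1 = 0"
    using constant_if_shift_invariant[of B] B by auto
  have AB1: "?o A B 1 = 0"
  proof -
    have "hd (drop 1 A) = c" "hd (take (n - 1) B) = hd B"
      using B(1,2) by (simp_all add: A_def hd_drop_conv_nth)
    with B(3) show ?thesis by auto
  qed
  have "correlation B B + correlation A B < correlation A A + correlation B A"
    unfolding correlation_def len B(1) sum.distrib[symmetric] distrib_right[symmetric]
  proof (rule sum_strict_mono_ex1)
    show "\<forall>d\<in>{..<n}. (?o B B d + ?o A B d) * (1 / 2) ^ d \<le> (?o A A d + ?o B A d) * (1 / 2) ^ d"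
      using overlap_replicate_le[OF B(1)] AA
      by (intro ballI mult_right_mono) (simp_all add: A_def)
    show "\<exists>d\<in>{..<n}. (?o B B d + ?o A B d) * (1 / 2) ^ d < (?o A A d + ?o B A d) * (1 / 2) ^ d"
      using AA[of 1] BB1 AB1 B(2) by (intro bexI[of _ 1]) auto
  qed simp
  then show ?thesis by linarith
qed

section \<open>Winning probabilities involving constant strings\<close>

lemma win_prob_nonneg: "win_prob A B \<ge> 0"
  by (simp add: win_prob_def)

lemma win_prob_replicate_ge:
  assumes B: "length B = n" "B \<noteq> replicate n c"
  shows "win_prob (replicate n c) B \<ge> 1 / 2"
proof -
  let ?A = "replicate n c"
  let ?x = "correlation ?A ?A - correlation ?A B"
  have "win_prob B ?A * ?x = win_prob ?A B * (correlation B B - correlation B ?A)"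
    using Conway_identity[of ?A n B] B by simp
  also have "\<dots> \<le> win_prob ?A B * ?x"
    by (intro mult_left_mono correlation_replicate(1)[OF B] win_prob_nonneg)
  finally have "win_prob B ?A \<le> win_prob ?A B"
    using correlation_replicate(2)[OF B] by simp
  then show ?thesis
    using win_prob_sum[of ?A n B] B by simp
qed

text \<open>This gives Player II's reply to a nonconstant string: repeat the letter with which it
  does not begin.\<close>

lemma win_prob_nonconstant_less:
  assumes A: "length A = n" "n \<ge> 2" "hd A \<noteq> c" "A \<noteq> replicate n (hd A)"
  shows "win_prob A (replicate n c) < 1 / 2"
proof -
  let ?B = "replicate n c"
  let ?x = "correlation ?B ?B - correlation ?B A"
  have ne: "A \<noteq> ?B"
  proof
    assume "A = ?B"
    moreover from this have "hd A = c"
      using A(2) by simp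
    ultimately show False
      using A(3) by simp
  qed
  have sum: "win_prob A ?B + win_prob ?B A = 1"
    using win_prob_sum[of A n ?B] A ne by simp
  \<comment> \<open>Positivity of this factor keeps the correlation inequality strict after
    multiplication.\<close>
  have "win_prob ?B A \<ge> 1 / 2"
    using win_prob_replicate_ge[OF A(1) ne] .
  then have "win_prob ?B A * (correlation A A - correlation A ?B) < win_prob ?B A * ?x"
    by (intro mult_strict_left_mono correlation_replicate_strict[OF A]) linarith
  moreover have "win_prob A ?B * ?x = win_prob ?B A * (correlation A A - correlation A ?B)"
    using Conway_identity[of A n ?B] A ne by simp
  ultimately have "win_prob A ?B * ?x < win_prob ?B A * ?x"
    by linarith
  then have "win_prob A ?B < win_prob ?B A"
    using correlation_replicate(2)[OF A(1) ne] by simp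
  with sum show ?thesis by linarith
qed

section \<open>Values of strings and optimal strategies\<close>

lemma other_coin: "\<exists>c' :: coin. c' \<noteq> c"
  by (cases c) auto

lemma value_replicate:
  assumes "n > 0"
  shows "value_against_best_reply n (replicate n c) = 1 / 2"
  unfolding value_against_best_reply_def
proof (rule Min_eqI)
  obtain c' where "c' \<noteq> c" using other_coin by blast
  let ?A = "replicate n c" and ?B = "replicate n c'"
  have ne: "?B \<noteq> ?A"
    using \<open>c' \<noteq> c\<close> assms by simp
  \<comment> \<open>The lower bound applies to both constant strings, and the two probabilities add
    up to 1, so the opposite constant attains the minimum.\<close>
  have "win_prob ?A ?B \<ge> 1 / 2" "win_prob ?B ?A \<ge> 1 / 2"
    using win_prob_replicate_ge[OF length_replicate] ne by metis+
  moreover have "win_prob ?A ?B + win_prob ?B ?A = 1"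
    by (rule win_prob_sum[OF length_replicate length_replicate ne[symmetric]])
  ultimately have "win_prob ?A ?B = 1 / 2"
    by linarith
  then show "1 / 2 \<in> win_prob ?A ` (strings n - {?A})"
    using ne by (intro image_eqI[of _ _ ?B]) (simp_all add: strings_def)
qed (use win_prob_replicate_ge finite_strings in \<open>auto simp: strings_def\<close>)

lemma value_nonconstant_less:
  assumes A: "length A = n" "n \<ge> 2" "\<And>c. A \<noteq> replicate n c"
  shows "value_against_best_reply n A < 1 / 2"
proof -
  obtain c where "c \<noteq> hd A" using other_coin by blast
  have "value_against_best_reply n A \<le> win_prob A (replicate n c)"
    unfolding value_against_best_reply_def
    using finite_strings A(3)[of c] by (intro Min_le) (auto simp: strings_def)
  also have "\<dots> < 1 / 2"
    using A \<open>c \<noteq> hd A\<close> by (intro win_prob_nonconstant_less) auto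
  finally show ?thesis .
qed

theorem theorem1p4:
  fixes n :: nat
  assumes "n \<ge> 3"
  shows "{A. optimal_strategy n A} = {replicate n Heads, replicate n Tails}
       \<and> card {A. optimal_strategy n A} = 2
       \<and> (\<forall>A. optimal_strategy n A \<longrightarrow> value_against_best_reply n A = 1 / 2)"
proof -
  have const: "value_against_best_reply n (replicate n c) = 1 / 2" for c
    using value_replicate assms by simp
  have less: "value_against_best_reply n A < 1 / 2" if "A \<in> strings n" "\<And>c. A \<noteq> replicate n c" for A
    using value_nonconstant_less[of A n] that assms by (simp add: strings_def)
  have le: "value_against_best_reply n A \<le> 1 / 2" if "A \<in> strings n" for A
    using const less[OF that] by (cases "\<exists>c. A = replicate n c") (auto intro: less_imp_le)
  have opt: "optimal_strategy n A \<longleftrightarrow> (\<exists>c. A = replicate n c)" for A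
  proof
    \<comment> \<open>Comparison with all heads gives an optimal string value at least 1/2, which no
      nonconstant string reaches.\<close>
    assume "optimal_strategy n A"
    moreover have "replicate n Heads \<in> strings n"
      by (simp add: strings_def)
    ultimately have "A \<in> strings n" "1 / 2 \<le> value_against_best_reply n A"
      unfolding optimal_strategy_def const[of Heads, symmetric] by blast+
    with less[of A] show "\<exists>c. A = replicate n c"
      by fastforce
  next
    assume "\<exists>c. A = replicate n c"
    then have "A \<in> strings n" "value_against_best_reply n A = 1 / 2"
      using const by (auto simp: strings_def)
    with le show "optimal_strategy n A"
      unfolding optimal_strategy_def by metis
  qed
  then have "{A. optimal_strategy n A} = range (replicate n)"
    by auto
  then have eq: "{A. optimal_strategy n A} = {replicate n Heads, replicate n Tails}"
    by (simp add: UNIV_coin)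
  moreover have "card {A. optimal_strategy n A} = 2"
    using assms by (simp add: eq)
  moreover have "value_against_best_reply n A = 1 / 2" if "optimal_strategy n A" for A
    using that const unfolding opt by blast
  ultimately show ?thesis
    by blast
qed

end
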